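(* Fix a round $t$ of the heterogeneous post-local algorithm and define $\eta_t:=\Lambda_t-L>0$. Let $$\mathcal H_t:=\sigma\bigl(\mathcal F_t,\{\mathcal B_{i,t,\ell}:i\in\mathcal S_t,\ 0\le\ell\le H_i-1\}\bigr).$$ Then, for every $\mathcal H_t$-measurable $w_t\in\Delta_n(\mathcal S_t)$, $$F(x_t+d_t(w_t))-F_\star\le f_t+\Psi_t^{\mathrm{het}}(w_t)+\frac1{2\eta_t}\|\nabla F(x_t)-c_t\|^2.$$ If $w_t^{\mathrm{het}}$ is an exact minimizer of $\Psi_t^{\mathrm{het}}$ over $\Delta_n(\mathcal S_t)$ (and $x_{t+1}=x_t+d_t(w_t^{\mathrm{het}})$), then $$F(x_{t+1})-F_\star\le f_t+\Psi_t^{\mathrm{het}}(w_t^{\mathrm{het}})+\frac1{2\eta_t}\|\nabla F(x_t)-c_t\|^2.$$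
   Context: Problem: $F(x)=\frac1n\sum_{i=1}^nF_i(x)$, $F_i(x)=\frac1{m_i}\sum_{j=1}^{m_i}\phi_{ij}(x)$, each $\phi_{ij}:\mathbb R^d\to\mathbb R$ convex and $L$-smooth ($L$-Lipschitz gradient). There are $x_\star\in\arg\min F$ and $R>0$; $B(x_\star,R)=\{x:\|x-x_\star\|\le R\}$, $F_\star:=F(x_\star)$, $f_t:=F(x_t)-F_\star$. $H_i\ge1$ is the horizon and $b_i$ the minibatch size of node $i$. Heterogeneous post-local algorithm, round $t$: inputs $x_t$, local controls $c_{i,t}$, server control $c_t$ (with $c_0=\frac1n\sum_ic_{i,0}$), nonempty active set $\mathcal S_t\subseteq[n]$, common amplitude $\vartheta_t\in[\underline\theta,\bar\theta]$ ($0<\underline\theta\le\bar\theta$), curvature $\Lambda_t>L$. Each $i\in\mathcal S_t$ sets $\eta_{i,t}=\vartheta_t/(LH_i)$, $y_{i,t}^{(0)}=x_t$; for $\ell=0,\dots,H_i-1$ it draws a minibatch $\mathcal B_{i,t,\ell}\subseteq[m_i]$ of size $b_i$, computes $g_{i,t,\ell}=\frac1{b_i}\sum_{j\in\mathcal B_{i,t,\ell}}\nabla\phi_{ij}(y_{i,t}^{(\ell)})$ and sets $y_{i,t}^{(\ell+1)}=y_{i,t}^{(\ell)}-\eta_{i,t}(g_{i,t,\ell}-c_{i,t}+c_t)$. Put $\Delta_{i,t}=y_{i,t}^{(H_i)}-x_t$, $c_{i,t+1}=c_{i,t}-c_t+\frac1{H_i\eta_{i,t}}(x_t-y_{i,t}^{(H_i)})$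 for $i\in\mathcal S_t$, and $c_{i,t+1}=c_{i,t}$ otherwise. Let $\widetilde\Delta_{i,t}=\Delta_{i,t}$ for $i\in\mathcal S_t$ and $\widetilde\Delta_{i,t}=0$ otherwise, $d_t(w):=\sum_{i=1}^nw_i\widetilde\Delta_{i,t}$, $$\Psi_t^{\mathrm{het}}(w):=\langle c_t,d_t(w)\rangle+\frac{\Lambda_t}2\|d_t(w)\|^2,\qquad \Delta_n(\mathcal S_t):=\Bigl\{w\in\mathbb R_+^n:\sum_iw_i=1,\ w_i=0\text{ for }i\notin\mathcal S_t\Bigr\}.$$ The server picks $w_t^{\mathrm{het}}\in\arg\min_{w\in\Delta_n(\mathcal S_t)}\Psi_t^{\mathrm{het}}(w)$ and sets $x_{t+1}=x_t+d_t(w_t^{\mathrm{het}})$, $c_{t+1}=c_t+\frac1n\sum_{i\in\mathcal S_t}(c_{i,t+1}-c_{i,t})$. $\mathcal F_t$ is the sigma-field generated by the initial state and all minibatches drawn strictly before round $t$; $\mathcal S_t$ is $\mathcal F_t$-measurable. Almost surely all $x_t$ and all $y_{i,t}^{(\ell)}$ lie in $B(x_\star,R)$. Inequalities between random variables hold almost surely. *)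

theory Defs
  imports "HOL-Probability.Probability"
begin

section \<open>Gradients and smoothness\<close>

definition grad :: "(real ^ 'd \<Rightarrow> real) \<Rightarrow> real ^ 'd \<Rightarrow> real ^ 'd" where
  "grad f x = (THE g. GDERIV f x :> g)"

lemma grad_eqI:
  assumes "GDERIV f x :> g"
  shows "grad f x = g"
  unfolding grad_def
proof (rule the_equality)
  fix g' assume "GDERIV f x :> g'"
  with assms have "(\<lambda>h. h \<bullet> g') = (\<lambda>h. h \<bullet> g)"
    unfolding gderiv_def by (metis has_derivative_unique)
  then show "g' = g"
    by (metis vector_eq_ldot)
qed (fact assms)

lemma GDERIV_grad:
  fixes f :: "real ^ 'd \<Rightarrow> real"
  assumes "f differentiable (at x)"
  shows "GDERIV f x :> grad f x"
proof -
  from assms obtain D where D: "(f has_derivative D) (at x)"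
    by (auto simp: differentiable_def)
  then interpret D: bounded_linear D
    by (rule has_derivative_bounded_linear)
  have "D h = h \<bullet> adjoint D 1" for h
    using adjoint_works[of D h 1] D.linear_axioms by (simp add: inner_commute)
  with D have "GDERIV f x :> adjoint D 1"
    unfolding gderiv_def by (metis (no_types, lifting) ext)
  then show ?thesis
    using grad_eqI by metis
qed

definition L_smooth :: "real \<Rightarrow> (real ^ 'd \<Rightarrow> real) \<Rightarrow> bool" where
  "L_smooth L f \<longleftrightarrow> (\<forall>x. f differentiable (at x)) \<and> L-lipschitz_on UNIV (grad f)"


section \<open>The finite-sum problem\<close>

text \<open>
  The nodes \<open>1, \<dots>, n\<close> are the elements of the finite index type \<open>'n\<close> (so \<open>n = CARD('n)\<close>);
  the samples of node \<open>i\<close> are \<open>1, \<dots>, nsamp P i\<close>.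
\<close>

record ('n, 'd) het_data =
  phi :: "'n \<Rightarrow> nat \<Rightarrow> real ^ 'd \<Rightarrow> real"
  nsamp :: "'n \<Rightarrow> nat"
  Lsm :: real
  xstar :: "real ^ 'd"
  radius :: real
  horizon :: "'n \<Rightarrow> nat"
  bsize :: "'n \<Rightarrow> nat"
  theta_lo :: real
  theta_hi :: real

definition local_obj :: "('n::finite, 'd::finite) het_data \<Rightarrow> 'n \<Rightarrow> real ^ 'd \<Rightarrow> real" where
  "local_obj P i x = 1 / real (nsamp P i) * (\<Sum>j = 1..nsamp P i. phi P i j x)"

definition global_obj :: "('n::finite, 'd::finite) het_data \<Rightarrow> real ^ 'd \<Rightarrow> real" where
  "global_obj P x = 1 / real CARD('n) * (\<Sum>i\<in>UNIV. local_obj P i x)"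

definition Fstar :: "('n::finite, 'd::finite) het_data \<Rightarrow> real" where
  "Fstar P = global_obj P (xstar P)"

definition het_problem :: "('n::finite, 'd::finite) het_data \<Rightarrow> bool" where
  "het_problem P \<longleftrightarrow>
     0 < Lsm P \<and>
     (\<forall>i. 1 \<le> nsamp P i) \<and>
     (\<forall>i. \<forall>j\<in>{1..nsamp P i}. convex_on UNIV (phi P i j) \<and> L_smooth (Lsm P) (phi P i j)) \<and>
     is_arg_min (global_obj P) (\<lambda>_. True) (xstar P) \<and>
     0 < radius P \<and>
     (\<forall>i. 1 \<le> horizon P i) \<and>
     (\<forall>i. 1 \<le> bsize P i) \<and>
     0 < theta_lo P \<and> theta_lo P \<le> theta_hi P"


section \<open>The heterogeneous post-local algorithm\<close>

text \<open>
  A run of the algorithm on a sample space \<open>'w\<close>: at round \<open>t\<close> and outcome \<open>\<omega>\<close>,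
  \<open>xit r t \<omega>\<close> is the server iterate, \<open>cserv r t \<omega>\<close> the server control, \<open>cloc r t i \<omega>\<close> the
  control of node \<open>i\<close>, \<open>act r t \<omega>\<close> the active set, \<open>amp r t \<omega>\<close> the amplitude
  \<open>\<vartheta>\<close>, \<open>curv r t \<omega>\<close> the curvature \<open>\<Lambda>\<close>, \<open>mb r i t l \<omega>\<close> the minibatch of node \<open>i\<close> at
  local step \<open>l\<close> (relevant only if \<open>i\<close> is active), and \<open>whet r t \<omega>\<close> the server weights.
\<close>

record ('w, 'n, 'd) het_run =
  xit :: "nat \<Rightarrow> 'w \<Rightarrow> real ^ 'd"
  cserv :: "nat \<Rightarrow> 'w \<Rightarrow> real ^ 'd"
  cloc :: "nat \<Rightarrow> 'n \<Rightarrow> 'w \<Rightarrow> real ^ 'd"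
  act :: "nat \<Rightarrow> 'w \<Rightarrow> 'n set"
  amp :: "nat \<Rightarrow> 'w \<Rightarrow> real"
  curv :: "nat \<Rightarrow> 'w \<Rightarrow> real"
  mb :: "'n \<Rightarrow> nat \<Rightarrow> nat \<Rightarrow> 'w \<Rightarrow> nat set"
  whet :: "nat \<Rightarrow> 'w \<Rightarrow> real ^ 'n"

definition step_size ::
    "('n::finite, 'd::finite) het_data \<Rightarrow> ('w, 'n, 'd) het_run \<Rightarrow> nat \<Rightarrow> 'n \<Rightarrow> 'w \<Rightarrow> real" where
  "step_size P r t i \<omega> = amp r t \<omega> / (Lsm P * real (horizon P i))"

definition minibatch_grad ::
    "('n::finite, 'd::finite) het_data \<Rightarrow> 'n \<Rightarrow> nat set \<Rightarrow> real ^ 'd \<Rightarrow> real ^ 'd" where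
  "minibatch_grad P i J y = (1 / real (bsize P i)) *\<^sub>R (\<Sum>j\<in>J. grad (phi P i j) y)"

primrec local_iter ::
    "('n::finite, 'd::finite) het_data \<Rightarrow> ('w, 'n, 'd) het_run \<Rightarrow> nat \<Rightarrow> 'n \<Rightarrow> 'w \<Rightarrow> nat \<Rightarrow> real ^ 'd" where
  "local_iter P r t i \<omega> 0 = xit r t \<omega>"
| "local_iter P r t i \<omega> (Suc l) =
     local_iter P r t i \<omega> l
       - step_size P r t i \<omega> *\<^sub>R
           (minibatch_grad P i (mb r i t l \<omega>) (local_iter P r t i \<omega> l)
              - cloc r t i \<omega> + cserv r t \<omega>)"

definition local_displ ::
    "('n::finite, 'd::finite) het_data \<Rightarrow> ('w, 'n, 'd) het_run \<Rightarrow> nat \<Rightarrow> 'n \<Rightarrow> 'w \<Rightarrow> real ^ 'd" where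
  "local_displ P r t i \<omega> =
     (if i \<in> act r t \<omega> then local_iter P r t i \<omega> (horizon P i) - xit r t \<omega> else 0)"

definition agg_displ ::
    "('n::finite, 'd::finite) het_data \<Rightarrow> ('w, 'n, 'd) het_run \<Rightarrow> nat \<Rightarrow> 'w \<Rightarrow> real ^ 'n \<Rightarrow> real ^ 'd" where
  "agg_displ P r t \<omega> w = (\<Sum>i\<in>UNIV. (w $ i) *\<^sub>R local_displ P r t i \<omega>)"

definition Psi_het ::
    "('n::finite, 'd::finite) het_data \<Rightarrow> ('w, 'n, 'd) het_run \<Rightarrow> nat \<Rightarrow> 'w \<Rightarrow> real ^ 'n \<Rightarrow> real" where
  "Psi_het P r t \<omega> w =
     cserv r t \<omega> \<bullet> agg_displ P r t \<omega> w + curv r t \<omega> / 2 * (norm (agg_displ P r t \<omega> w))\<^sup>2"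

definition active_simplex :: "'n set \<Rightarrow> (real ^ 'n::finite) set" where
  "active_simplex S =
     {w. (\<forall>i. 0 \<le> w $ i) \<and> (\<Sum>i\<in>UNIV. w $ i) = 1 \<and> (\<forall>i. i \<notin> S \<longrightarrow> w $ i = 0)}"

text \<open>
  Only active nodes draw minibatches.  Since drawn minibatches are nonempty, \<open>{}\<close> encodes that
  nothing is drawn; with this encoding the sigma-field of a family of minibatches indexed by the
  random set \<open>{i. i \<in> act r t \<omega>}\<close> is that of the family \<open>drawn r i t l\<close> over all \<open>i\<close>.
\<close>

definition drawn :: "('w, 'n::finite, 'd::finite) het_run \<Rightarrow> 'n \<Rightarrow> nat \<Rightarrow> nat \<Rightarrow> 'w \<Rightarrow> nat set" where
  "drawn r i t l \<omega> = (if i \<in> act r t \<omega> then mb r i t l \<omega> else {})"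

text \<open>
  The history before round \<open>t\<close>: the initial state is \<open>x\<^sub>0\<close> and all local controls at time \<open>0\<close>,
  which determine \<open>c\<^sub>0\<close>.
\<close>

definition fieldF ::
    "'w measure \<Rightarrow> ('n::finite, 'd::finite) het_data \<Rightarrow> ('w, 'n, 'd) het_run \<Rightarrow> nat \<Rightarrow> 'w measure" where
  "fieldF M P r t = sigma (space M)
     ({xit r 0 -` A \<inter> space M | A. A \<in> sets borel} \<union>
      {cloc r 0 i -` A \<inter> space M | i A. A \<in> sets borel} \<union>
      {drawn r i s l -` A \<inter> space M | i s l A. s < t \<and> l < horizon P i})"

definition fieldH ::
    "'w measure \<Rightarrow> ('n::finite, 'd::finite) het_data \<Rightarrow> ('w, 'n, 'd) het_run \<Rightarrow> nat \<Rightarrow> 'w measure" where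
  "fieldH M P r t = sigma (space M)
     (sets (fieldF M P r t) \<union>
      {drawn r i t l -` A \<inter> space M | i l A. l < horizon P i})"

definition het_post_local ::
    "'w measure \<Rightarrow> ('n::finite, 'd::finite) het_data \<Rightarrow> ('w, 'n, 'd) het_run \<Rightarrow> bool" where
  "het_post_local M P r \<longleftrightarrow>
     \<comment> \<open>random inputs\<close>
     xit r 0 \<in> borel_measurable M \<and>
     (\<forall>i. cloc r 0 i \<in> borel_measurable M) \<and>
     (\<forall>i t l. l < horizon P i \<longrightarrow> drawn r i t l \<in> measurable M (count_space UNIV)) \<and>
     (\<forall>t. act r t \<in> measurable (fieldF M P r t) (count_space UNIV)) \<and>
     \<comment> \<open>pathwise dynamics\<close>
     (\<forall>\<omega>\<in>space M.
        cserv r 0 \<omega> = (1 / real CARD('n)) *\<^sub>R (\<Sum>i\<in>UNIV. cloc r 0 i \<omega>) \<and>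
        (\<forall>t.
           act r t \<omega> \<noteq> {} \<and>
           amp r t \<omega> \<in> {theta_lo P..theta_hi P} \<and>
           Lsm P < curv r t \<omega> \<and>
           (\<forall>i\<in>act r t \<omega>. \<forall>l<horizon P i.
              mb r i t l \<omega> \<subseteq> {1..nsamp P i} \<and> card (mb r i t l \<omega>) = bsize P i) \<and>
           (\<forall>i. cloc r (Suc t) i \<omega> =
              (if i \<in> act r t \<omega>
               then cloc r t i \<omega> - cserv r t \<omega>
                    + (1 / (real (horizon P i) * step_size P r t i \<omega>)) *\<^sub>R
                        (xit r t \<omega> - local_iter P r t i \<omega> (horizon P i))
               else cloc r t i \<omega>)) \<and>
           is_arg_min (Psi_het P r t \<omega>) (\<lambda>w. w \<in> active_simplex (act r t \<omega>)) (whet r t \<omega>) \<and>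
           xit r (Suc t) \<omega> = xit r t \<omega> + agg_displ P r t \<omega> (whet r t \<omega>) \<and>
           cserv r (Suc t) \<omega> = cserv r t \<omega>
             + (1 / real CARD('n)) *\<^sub>R
                 (\<Sum>i\<in>act r t \<omega>. cloc r (Suc t) i \<omega> - cloc r t i \<omega>))) \<and>
     \<comment> \<open>almost sure localization\<close>
     (AE \<omega> in M. \<forall>t.
        xit r t \<omega> \<in> cball (xstar P) (radius P) \<and>
        (\<forall>i\<in>act r t \<omega>. \<forall>l\<le>horizon P i.
           local_iter P r t i \<omega> l \<in> cball (xstar P) (radius P)))"

definition fgap :: "('n::finite, 'd::finite) het_data \<Rightarrow> ('w, 'n, 'd) het_run \<Rightarrow> nat \<Rightarrow> 'w \<Rightarrow> real" where
  "fgap P r t \<omega> = global_obj P (xit r t \<omega>) - Fstar P"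

definition eta :: "('n::finite, 'd::finite) het_data \<Rightarrow> ('w, 'n, 'd) het_run \<Rightarrow> nat \<Rightarrow> 'w \<Rightarrow> real" where
  "eta P r t \<omega> = curv r t \<omega> - Lsm P"

end

theory Submission
  imports Defs
begin

text \<open>
  The inequality holds pathwise, for every direction \<open>d\<close> in place of \<open>d\<^sub>t(w)\<close>.  An average of
  \<open>L\<close>-smooth functions is \<open>L\<close>-smooth, so \<open>F\<close> is (\<open>global_obj_L_smooth\<close>), and the descent lemma
  (\<open>L_smooth_descent\<close>) gives
  \<open>F(x + d) \<le> F(x) + \<langle>\<nabla>F(x), d\<rangle> + L/2 \<parallel>d\<parallel>\<^sup>2\<close>.  In the linear term, \<open>\<nabla>F(x)\<close> is replaced by the
  control \<open>c\<close> and Young's inequality with weight \<open>\<eta> = \<Lambda> - L\<close> bounds the error: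
  \<open>\<langle>\<nabla>F(x) - c, d\<rangle> \<le> \<eta>/2 \<parallel>d\<parallel>\<^sup>2 + 1/(2\<eta>) \<parallel>\<nabla>F(x) - c\<parallel>\<^sup>2\<close>.  The two quadratic terms add up to
  \<open>\<Lambda>/2 \<parallel>d\<parallel>\<^sup>2\<close>, which together with \<open>\<langle>c, d\<rangle>\<close> is the surrogate \<open>\<Psi>\<close>.
\<close>

lemma GDERIV_average:
  fixes f :: "'i \<Rightarrow> real ^ 'd \<Rightarrow> real"
  assumes "\<And>i. i \<in> I \<Longrightarrow> GDERIV (f i) x :> g i"
  shows "GDERIV (\<lambda>x. 1 / real (card I) * (\<Sum>i\<in>I. f i x)) x
           :> (1 / real (card I)) *\<^sub>R (\<Sum>i\<in>I. g i)"
proof -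
  have "((\<lambda>x. \<Sum>i\<in>I. f i x) has_derivative (\<lambda>h. \<Sum>i\<in>I. h \<bullet> g i)) (at x)"
    using assms unfolding gderiv_def by (intro has_derivative_sum) auto
  from has_derivative_mult_right[OF this, of "1 / real (card I)"] show ?thesis
    unfolding gderiv_def by (simp add: inner_sum_right)
qed

lemma L_smooth_average:
  fixes f :: "'i \<Rightarrow> real ^ 'd \<Rightarrow> real"
  assumes "finite I" and "I \<noteq> {}" and sm: "\<And>i. i \<in> I \<Longrightarrow> L_smooth L (f i)"
  shows "L_smooth L (\<lambda>x. 1 / real (card I) * (\<Sum>i\<in>I. f i x))"
    (is "L_smooth L ?F")
proof -
  have card: "real (card I) > 0"
    using assms(1,2) by (simp add: card_gt_0_iff)
  have L: "0 \<le> L"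
    using assms(2) sm lipschitz_on_nonneg unfolding L_smooth_def by blast
  have G: "GDERIV ?F x :> (1 / real (card I)) *\<^sub>R (\<Sum>i\<in>I. grad (f i) x)" for x
    using sm by (intro GDERIV_average GDERIV_grad) (auto simp: L_smooth_def)
  have "dist (grad ?F x) (grad ?F y) \<le> L * dist x y" for x y
  proof -
    have "norm (\<Sum>i\<in>I. grad (f i) x - grad (f i) y)
            \<le> (\<Sum>i\<in>I. norm (grad (f i) x - grad (f i) y))"
      by (rule norm_sum)
    also have "\<dots> \<le> (\<Sum>i\<in>I. L * dist x y)"
      using sm by (intro sum_mono) (auto simp: L_smooth_def lipschitz_on_def dist_norm)
    finally have "norm (\<Sum>i\<in>I. grad (f i) x - grad (f i) y) \<le> real (card I) * (L * dist x y)"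
      by simp
    moreover have "grad ?F x - grad ?F y
        = (1 / real (card I)) *\<^sub>R (\<Sum>i\<in>I. grad (f i) x - grad (f i) y)"
      unfolding grad_eqI[OF G] by (simp add: sum_subtractf scaleR_right_diff_distrib)
    ultimately show ?thesis
      using card by (simp add: dist_norm field_simps)
  qed
  then have "L-lipschitz_on UNIV (grad ?F)"
    using L by (auto intro: lipschitz_onI)
  moreover have "?F differentiable (at x)" for x
    using G[of x] unfolding gderiv_def differentiable_def by blast
  ultimately show ?thesis
    unfolding L_smooth_def by blast
qed

lemma L_smooth_descent:
  fixes f :: "real ^ 'd \<Rightarrow> real"
  assumes "L_smooth L f"
  shows "f (x + d) \<le> f x + grad f x \<bullet> d + L / 2 * (norm d)\<^sup>2"
proof -
  \<comment> \<open>The claim is \<open>p 1 \<le> p 0\<close>; the Lipschitz bound on the gradient makes \<open>p\<close> nonincreasing on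
    \<open>[0, 1]\<close>, so no integral of the gradient along the segment is needed.\<close>
  define p where "p s = f (x + s *\<^sub>R d) - s * (grad f x \<bullet> d) - L / 2 * s\<^sup>2 * (norm d)\<^sup>2" for s :: real
  have deriv: "(p has_real_derivative
      (grad f (x + s *\<^sub>R d) - grad f x) \<bullet> d - L * s * (norm d)\<^sup>2) (at s)" for s
  proof -
    have "(f has_derivative (\<lambda>h. h \<bullet> grad f (x + s *\<^sub>R d))) (at (x + s *\<^sub>R d))"
      using assms GDERIV_grad unfolding L_smooth_def gderiv_def by blast
    then have "((\<lambda>s. f (x + s *\<^sub>R d)) has_derivative (\<lambda>h. (h *\<^sub>R d) \<bullet> grad f (x + s *\<^sub>R d))) (at s)"
      by (rule has_derivative_compose[rotated]) (auto intro!: derivative_eq_intros)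
    then have "((\<lambda>s. f (x + s *\<^sub>R d)) has_real_derivative grad f (x + s *\<^sub>R d) \<bullet> d) (at s)"
      unfolding has_field_derivative_def
      by (rule has_derivative_eq_rhs) (simp add: fun_eq_iff inner_commute)
    then show ?thesis
      unfolding p_def
      by (auto intro!: derivative_eq_intros simp: inner_diff_left)
  qed
  have "p 1 \<le> p 0"
  proof (rule DERIV_nonpos_imp_nonincreasing[of 0 1 p])
    fix s :: real
    assume s: "0 \<le> s" "s \<le> 1"
    have "(grad f (x + s *\<^sub>R d) - grad f x) \<bullet> d \<le> norm (grad f (x + s *\<^sub>R d) - grad f x) * norm d"
      by (rule norm_cauchy_schwarz)
    also have "\<dots> \<le> (L * norm (s *\<^sub>R d)) * norm d"
      using lipschitz_onD[of L UNIV "grad f" "x + s *\<^sub>R d" x] assms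
      by (intro mult_right_mono) (auto simp: L_smooth_def dist_norm)
    finally have "(grad f (x + s *\<^sub>R d) - grad f x) \<bullet> d - L * s * (norm d)\<^sup>2 \<le> 0"
      using s by (simp add: power2_eq_square mult.assoc)
    with deriv[of s] show "\<exists>y. (p has_real_derivative y) (at s) \<and> y \<le> 0"
      by blast
  qed simp
  then show ?thesis
    by (simp add: p_def)
qed

lemma inner_le_Young:
  fixes u v :: "'a::real_inner"
  assumes "0 < e"
  shows "u \<bullet> v \<le> e / 2 * (norm v)\<^sup>2 + 1 / (2 * e) * (norm u)\<^sup>2"
proof -
  have "0 \<le> (norm (u - e *\<^sub>R v))\<^sup>2"
    by simp
  also have "\<dots> = (norm u)\<^sup>2 - 2 * e * (u \<bullet> v) + e\<^sup>2 * (norm v)\<^sup>2"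
    unfolding power2_norm_eq_inner
    by (simp add: inner_diff_left inner_diff_right inner_commute power2_eq_square)
  finally have "2 * e * (u \<bullet> v) \<le> (norm u)\<^sup>2 + e\<^sup>2 * (norm v)\<^sup>2"
    by simp
  with assms show ?thesis
    by (simp add: field_simps power2_eq_square)
qed

text \<open>
  The descent lemma with an arbitrary vector \<open>c\<close> in place of the gradient: the surplus \<open>K - L\<close> of
  the curvature over the smoothness constant pays for the mismatch \<open>grad f x - c\<close>.
\<close>

lemma L_smooth_inexact_descent:
  fixes f :: "real ^ 'd \<Rightarrow> real"
  assumes "L_smooth L f" and "L < K"
  shows "f (x + d) \<le> f x + (c \<bullet> d + K / 2 * (norm d)\<^sup>2)
           + 1 / (2 * (K - L)) * (norm (grad f x - c))\<^sup>2"
proof -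
  have "f (x + d) \<le> f x + grad f x \<bullet> d + L / 2 * (norm d)\<^sup>2"
    using assms(1) by (rule L_smooth_descent)
  moreover have "(grad f x - c) \<bullet> d
      \<le> (K - L) / 2 * (norm d)\<^sup>2 + 1 / (2 * (K - L)) * (norm (grad f x - c))\<^sup>2"
    using assms(2) by (intro inner_le_Young) simp
  ultimately show ?thesis
    by (simp add: inner_diff_left diff_divide_distrib left_diff_distrib)
qed

lemma global_obj_L_smooth:
  fixes P :: "('n::finite, 'd::finite) het_data"
  assumes "het_problem P"
  shows "L_smooth (Lsm P) (global_obj P)"
proof -
  have local: "L_smooth (Lsm P) (local_obj P i)" for i
  proof -
    have "{1..nsamp P i} \<noteq> {}"
      using assms by (simp add: het_problem_def)
    then have "L_smooth (Lsm P)
        (\<lambda>x. 1 / real (card {1..nsamp P i}) * (\<Sum>j\<in>{1..nsamp P i}. phi P i j x))"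
      using assms by (intro L_smooth_average) (auto simp: het_problem_def)
    then show ?thesis
      by (simp add: local_obj_def[abs_def])
  qed
  then have "L_smooth (Lsm P) (\<lambda>x. 1 / real (card (UNIV :: 'n set)) * (\<Sum>i\<in>UNIV. local_obj P i x))"
    by (intro L_smooth_average) auto
  then show ?thesis
    by (simp add: global_obj_def[abs_def])
qed

theorem theorem4p1:
  fixes M :: "'w measure"
    and P :: "('n::finite, 'd::finite) het_data"
    and r :: "('w, 'n, 'd) het_run"
    and t :: nat
  assumes "prob_space M"
    and "het_problem P"
    and "het_post_local M P r"
  shows "(\<forall>w :: 'w \<Rightarrow> real ^ 'n.
            w \<in> borel_measurable (fieldH M P r t) \<longrightarrow>
            (AE \<omega> in M. w \<omega> \<in> active_simplex (act r t \<omega>)) \<longrightarrow>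
            (AE \<omega> in M.
               global_obj P (xit r t \<omega> + agg_displ P r t \<omega> (w \<omega>)) - Fstar P
                 \<le> fgap P r t \<omega> + Psi_het P r t \<omega> (w \<omega>)
                    + 1 / (2 * eta P r t \<omega>)
                      * (norm (grad (global_obj P) (xit r t \<omega>) - cserv r t \<omega>))\<^sup>2))
       \<and> (\<forall>wh :: 'w \<Rightarrow> real ^ 'n.
            (AE \<omega> in M. is_arg_min (Psi_het P r t \<omega>)
               (\<lambda>v. v \<in> active_simplex (act r t \<omega>)) (wh \<omega>)) \<longrightarrow>
            (AE \<omega> in M. xit r (Suc t) \<omega> = xit r t \<omega> + agg_displ P r t \<omega> (wh \<omega>)) \<longrightarrow>
            (AE \<omega> in M.
               global_obj P (xit r (Suc t) \<omega>) - Fstar P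
                 \<le> fgap P r t \<omega> + Psi_het P r t \<omega> (wh \<omega>)
                    + 1 / (2 * eta P r t \<omega>)
                      * (norm (grad (global_obj P) (xit r t \<omega>) - cserv r t \<omega>))\<^sup>2))"
proof -
  have bound: "global_obj P (xit r t \<omega> + agg_displ P r t \<omega> v) - Fstar P
      \<le> fgap P r t \<omega> + Psi_het P r t \<omega> v
         + 1 / (2 * eta P r t \<omega>) * (norm (grad (global_obj P) (xit r t \<omega>) - cserv r t \<omega>))\<^sup>2"
    if "\<omega> \<in> space M" for \<omega> v
  proof -
    have "Lsm P < curv r t \<omega>"
      using assms(3) that unfolding het_post_local_def by blast
    from L_smooth_inexact_descent[OF global_obj_L_smooth[OF assms(2)] this] show ?thesis
      unfolding fgap_def Psi_het_def eta_def by (simp add: algebra_simps)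
  qed
  show ?thesis
  proof (intro conjI allI impI)
    fix wh :: "'w \<Rightarrow> real ^ 'n"
    assume "AE \<omega> in M. xit r (Suc t) \<omega> = xit r t \<omega> + agg_displ P r t \<omega> (wh \<omega>)"
    then show "AE \<omega> in M. global_obj P (xit r (Suc t) \<omega>) - Fstar P
        \<le> fgap P r t \<omega> + Psi_het P r t \<omega> (wh \<omega>)
           + 1 / (2 * eta P r t \<omega>) * (norm (grad (global_obj P) (xit r t \<omega>) - cserv r t \<omega>))\<^sup>2"
      using AE_space by eventually_elim (simp only: bound)
  qed (intro AE_I2 bound)
qed

end
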